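(* Let $g \geq 1$ be an integer, let $F_{2g}$ be the free group on $a_1,\ldots,a_g,b_1,\ldots,b_g$, let $B_{2g+2}$ be the braid group on $2g+2$ strands with standard generators $\sigma_1,\ldots,\sigma_{2g+1}$, and let $u_1,\ldots,u_{2g+1}$ be the automorphisms of $F_{2g}$ defined in the context. Then there is a group homomorphism $f : B_{2g+2} \to \operatorname{Aut}(F_{2g})$ such that $f(\sigma_i) = u_i$ for all $i = 1, \ldots, 2g+1$.
   Context: The braid group $B_{2g+2}$ is the group with generators $\sigma_1,\ldots,\sigma_{2g+1}$ and relations, for $1\le i,j\le 2g+1$: $\sigma_i\sigma_j=\sigma_j\sigma_i$ if $|i-j|>1$, and $\sigma_i\sigma_j\sigma_i=\sigma_j\sigma_i\sigma_j$ if $|i-j|=1$. The product in $\operatorname{Aut}(F_{2g})$ is composition of automorphisms. The automorphisms $u_1,\ldots,u_{2g+1}$ of $F_{2g}$ are defined as follows. - $u_1$ fixes all generators except $b_1$, and $u_1(b_1)=a_1b_1$. - $u_{2g+1}$ fixes all generators except $b_g$, and $u_{2g+1}(b_g)=b_ga_g$. - For $i=1,\ldots,g$, $u_{2i}$ fixes all generators except $a_i$, and $u_{2i}(a_i)=b_i^{-1}a_i$. - For $i=1,\ldots,g-1$, $u_{2i+1}$ fixes all generators except $b_i$ and $b_{i+1}$, and $u_{2i+1}(b_i)=b_ia_ia_{i+1}^{-1}$, $u_{2i+1}(b_{i+1})=a_{i+1}a_i^{-1}b_{i+1}$. *)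

theory Defs
  imports "HOL-Algebra.Algebra"
begin

section \<open>Free groups\<close>

text \<open>
  A letter is a generator together with a sign: \<open>(s, True)\<close> stands for \<open>s\<close> and \<open>(s, False)\<close> for its
  inverse. Elements of the free group are the reduced words.
\<close>

type_synonym 'a word = "('a \<times> bool) list"

definition inv_letter :: "'a \<times> bool \<Rightarrow> 'a \<times> bool" where
  "inv_letter x = (fst x, \<not> snd x)"

definition reduced :: "'a word \<Rightarrow> bool" where
  "reduced w \<longleftrightarrow> successively (\<lambda>x y. y \<noteq> inv_letter x) w"

text \<open>Left multiplication of a reduced word by a letter, followed by reduction.\<close>

fun push :: "'a \<times> bool \<Rightarrow> 'a word \<Rightarrow> 'a word" where
  "push x [] = [x]"
| "push x (y # w) = (if y = inv_letter x then w else x # y # w)"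

definition free_group :: "'a set \<Rightarrow> 'a word monoid" where
  "free_group S =
    \<lparr>carrier = {w. reduced w \<and> fst ` set w \<subseteq> S},
     monoid.mult = (\<lambda>v w. foldr push v w),
     one = []\<rparr>"

definition free_gen :: "'a \<Rightarrow> 'a word" where
  "free_gen s = [(s, True)]"

text \<open>The homomorphism out of the free group on \<open>S\<close> extending a map \<open>\<phi>\<close> on the generators.\<close>

definition free_lift ::
  "'a set \<Rightarrow> ('b, 'c) monoid_scheme \<Rightarrow> ('a \<Rightarrow> 'b) \<Rightarrow> 'a word \<Rightarrow> 'b" where
  "free_lift S H \<phi> =
    (\<lambda>w \<in> carrier (free_group S).
       foldr (\<lambda>(s, e) h. (if e then \<phi> s else inv\<^bsub>H\<^esub> \<phi> s) \<otimes>\<^bsub>H\<^esub> h) w \<one>\<^bsub>H\<^esub>)"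

lemma inv_letter_inv [simp]: "inv_letter (inv_letter x) = x"
  by (simp add: inv_letter_def)

lemma inv_letter_neq [simp]: "inv_letter x \<noteq> x" "x \<noteq> inv_letter x"
  by (metis inv_letter_def snd_conv)+

lemma fst_inv_letter [simp]: "fst (inv_letter x) = fst x"
  by (simp add: inv_letter_def)

lemma reduced_Nil [simp]: "reduced []"
  by (simp add: reduced_def)

lemma reduced_Cons: "reduced (x # w) \<longleftrightarrow> reduced w \<and> (w = [] \<or> hd w \<noteq> inv_letter x)"
  by (auto simp: reduced_def successively_Cons)

lemma reduced_push: "reduced w \<Longrightarrow> reduced (push x w)"
  by (cases w) (auto simp: reduced_Cons)

lemma push_reduced: "reduced (x # w) \<Longrightarrow> push x w = x # w"
  by (cases w) (auto simp: reduced_Cons)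

lemma push_inv_push: "reduced w \<Longrightarrow> push (inv_letter x) (push x w) = w"
  by (cases w) (auto simp: reduced_Cons push_reduced)

lemma push_push_inv: "reduced w \<Longrightarrow> push x (push (inv_letter x) w) = w"
  using push_inv_push[of w "inv_letter x"] by simp

lemma set_push: "set (push x w) \<subseteq> insert x (set w)"
  by (cases w) auto

lemma reduced_foldr_push: "reduced w \<Longrightarrow> reduced (foldr push v w)"
  by (induction v) (auto intro: reduced_push)

lemma set_foldr_push: "set (foldr push v w) \<subseteq> set v \<union> set w"
  using set_push by (induction v) fastforce+

lemma foldr_push_push:
  assumes "reduced w"
  shows "foldr push (push x v) w = push x (foldr push v w)"
  by (cases v) (auto simp: push_push_inv reduced_foldr_push assms)

lemma foldr_push_assoc:
  "reduced w \<Longrightarrow> foldr push (foldr push u v) w = foldr push u (foldr push v w)"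
  by (induction u) (auto simp: foldr_push_push)

lemma foldr_push_Nil: "reduced v \<Longrightarrow> foldr push v [] = v"
  by (induction v) (auto simp: reduced_Cons push_reduced)

lemma foldr_push_inverse:
  "foldr push (rev (map inv_letter v)) v = []"
  by (induction v) auto

lemma reduced_inverse: "reduced v \<Longrightarrow> reduced (rev (map inv_letter v))"
  unfolding reduced_def successively_rev successively_map
  by (erule successively_mono) (metis inv_letter_inv)

lemma group_free_group: "group (free_group S)"
proof (rule groupI)
  fix v w assume "v \<in> carrier (free_group S)" "w \<in> carrier (free_group S)"
  then show "v \<otimes>\<^bsub>free_group S\<^esub> w \<in> carrier (free_group S)"
    using set_foldr_push[of v w] by (fastforce simp: free_group_def reduced_foldr_push)
next
  fix v assume v: "v \<in> carrier (free_group S)"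
  have "rev (map inv_letter v) \<in> carrier (free_group S)"
    using v by (auto simp: free_group_def reduced_inverse)
  moreover have "rev (map inv_letter v) \<otimes>\<^bsub>free_group S\<^esub> v = \<one>\<^bsub>free_group S\<^esub>"
    by (simp add: free_group_def foldr_push_inverse)
  ultimately show
    "\<exists>w\<in>carrier (free_group S). w \<otimes>\<^bsub>free_group S\<^esub> v = \<one>\<^bsub>free_group S\<^esub>"
    by blast
qed (auto simp: free_group_def foldr_push_assoc)

lemma free_gen_closed: "s \<in> S \<Longrightarrow> free_gen s \<in> carrier (free_group S)"
  by (auto simp: free_group_def free_gen_def reduced_Cons)

lemma free_lift_hom:
  assumes "group H" and \<phi>: "\<phi> \<in> S \<rightarrow> carrier H"
  shows "free_lift S H \<phi> \<in> hom (free_group S) H"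
proof -
  interpret H: group H by fact
  define l where "l = (\<lambda>x. if snd x then \<phi> (fst x) else inv\<^bsub>H\<^esub> \<phi> (fst x))"
  define E where "E = (\<lambda>w. foldr (\<lambda>x h. l x \<otimes>\<^bsub>H\<^esub> h) w \<one>\<^bsub>H\<^esub>)"
  have E: "free_lift S H \<phi> w = E w" if "w \<in> carrier (free_group S)" for w
    using that by (auto simp: free_lift_def E_def l_def case_prod_beta' intro!: foldr_cong)
  have l: "l x \<in> carrier H" if "fst x \<in> S" for x
    using \<phi> that by (auto simp: l_def)
  have E_closed: "E w \<in> carrier H" if "fst ` set w \<subseteq> S" for w
    using that l by (induction w) (auto simp: E_def)
  have E_push: "E (push x w) = l x \<otimes>\<^bsub>H\<^esub> E w" if "fst x \<in> S" "fst ` set w \<subseteq> S" for x w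
  proof (cases "\<exists>w'. w = inv_letter x # w'")
    case True
    then obtain w' where w: "w = inv_letter x # w'" by blast
    have "l x \<otimes>\<^bsub>H\<^esub> l (inv_letter x) = \<one>\<^bsub>H\<^esub>"
      using that funcset_mem[OF \<phi>] by (auto simp: l_def inv_letter_def)
    moreover have "E w' \<in> carrier H" using that w by (auto intro: E_closed)
    ultimately have "l x \<otimes>\<^bsub>H\<^esub> (l (inv_letter x) \<otimes>\<^bsub>H\<^esub> E w') = E w'"
      using l that by (simp flip: H.m_assoc)
    then show ?thesis by (simp add: w E_def)
  next
    case False
    then show ?thesis by (cases w) (auto simp: E_def)
  qed
  have E_mult: "E (foldr push v w) = E v \<otimes>\<^bsub>H\<^esub> E w"
    if "fst ` set v \<subseteq> S" "fst ` set w \<subseteq> S" for v w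
    using that(1)
  proof (induction v)
    case Nil
    then show ?case using E_closed[OF that(2)] by (simp add: E_def)
  next
    case (Cons x v)
    have "fst ` set (foldr push v w) \<subseteq> S"
      using set_foldr_push[of v w] Cons.prems that(2) by fastforce
    then have "E (foldr push (x # v) w) = l x \<otimes>\<^bsub>H\<^esub> (E v \<otimes>\<^bsub>H\<^esub> E w)"
      using Cons E_push by simp
    also have "\<dots> = (l x \<otimes>\<^bsub>H\<^esub> E v) \<otimes>\<^bsub>H\<^esub> E w"
      using Cons.prems l E_closed that(2) by (simp add: H.m_assoc)
    finally show ?case by (simp add: E_def)
  qed
  interpret F: group "free_group S" by (rule group_free_group)
  show ?thesis
  proof (rule homI)
    fix w assume "w \<in> carrier (free_group S)"
    then show "free_lift S H \<phi> w \<in> carrier H"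
      by (simp add: E) (auto simp: free_group_def intro: E_closed)
  next
    fix v w assume vw: "v \<in> carrier (free_group S)" "w \<in> carrier (free_group S)"
    then have "free_lift S H \<phi> (v \<otimes>\<^bsub>free_group S\<^esub> w) = E (foldr push v w)"
      using E[OF F.m_closed[OF vw]] by (simp add: free_group_def)
    also have "\<dots> = E v \<otimes>\<^bsub>H\<^esub> E w"
      using vw by (intro E_mult) (auto simp: free_group_def)
    finally show "free_lift S H \<phi> (v \<otimes>\<^bsub>free_group S\<^esub> w) =
        free_lift S H \<phi> v \<otimes>\<^bsub>H\<^esub> free_lift S H \<phi> w"
      using vw by (simp add: E)
  qed
qed

lemma free_lift_gen:
  assumes "group H" "\<phi> \<in> S \<rightarrow> carrier H" "s \<in> S"
  shows "free_lift S H \<phi> (free_gen s) = \<phi> s"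
  using assms free_gen_closed[of s S]
  by (auto simp: free_lift_def free_gen_def intro!: monoid.r_one group.is_monoid)

lemma free_group_generated: "generate (free_group S) (free_gen ` S) = carrier (free_group S)"
proof
  interpret F: group "free_group S" by (rule group_free_group)
  show "generate (free_group S) (free_gen ` S) \<subseteq> carrier (free_group S)"
    by (rule F.generate_incl) (auto intro: free_gen_closed)
  show "carrier (free_group S) \<subseteq> generate (free_group S) (free_gen ` S)"
  proof
    fix w assume "w \<in> carrier (free_group S)"
    then show "w \<in> generate (free_group S) (free_gen ` S)"
    proof (induction w)
      case Nil
      then show ?case using generate.one[of "free_group S"] by (simp add: free_group_def)
    next
      case (Cons x w)
      obtain s e where x: "x = (s, e)" by (cases x)
      have s: "s \<in> S" and w: "w \<in> carrier (free_group S)" and red: "reduced (x # w)"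
        using Cons.prems x by (auto simp: free_group_def reduced_Cons)
      have "inv\<^bsub>free_group S\<^esub> free_gen s = [(s, False)]"
        using s by (intro F.inv_equality)
          (auto simp: free_group_def free_gen_def reduced_Cons inv_letter_def)
      then have "[x] \<in> generate (free_group S) (free_gen ` S)"
        using generate.inv[of "free_gen s" "free_gen ` S" "free_group S"]
          generate.incl[of "free_gen s" "free_gen ` S" "free_group S"] s x
        by (cases e) (auto simp: free_gen_def)
      then have "[x] \<otimes>\<^bsub>free_group S\<^esub> w \<in> generate (free_group S) (free_gen ` S)"
        using Cons.IH[OF w] by (rule generate.eng)
      then show ?case using red by (simp add: free_group_def push_reduced)
    qed
  qed
qed


section \<open>Groups given by generators and relations\<close>

definition normal_closure :: "('a, 'b) monoid_scheme \<Rightarrow> 'a set \<Rightarrow> 'a set" where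
  "normal_closure G R =
    generate G {x \<otimes>\<^bsub>G\<^esub> r \<otimes>\<^bsub>G\<^esub> inv\<^bsub>G\<^esub> x | x r. x \<in> carrier G \<and> r \<in> R}"

text \<open>A pair \<open>(v, w)\<close> in \<open>R\<close> encodes the relation \<open>v = w\<close>.\<close>

definition relators :: "'a set \<Rightarrow> ('a word \<times> 'a word) set \<Rightarrow> 'a word set" where
  "relators S R = {v \<otimes>\<^bsub>free_group S\<^esub> inv\<^bsub>free_group S\<^esub> w | v w. (v, w) \<in> R}"

definition presented_group :: "'a set \<Rightarrow> ('a word \<times> 'a word) set \<Rightarrow> 'a word set monoid" where
  "presented_group S R = free_group S Mod normal_closure (free_group S) (relators S R)"

definition presented_gen :: "'a set \<Rightarrow> ('a word \<times> 'a word) set \<Rightarrow> 'a \<Rightarrow> 'a word set" where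
  "presented_gen S R s =
    normal_closure (free_group S) (relators S R) #>\<^bsub>free_group S\<^esub> free_gen s"

lemma (in group) normal_closure_normal:
  assumes "R \<subseteq> carrier G"
  shows "normal_closure G R \<lhd> G"
  unfolding normal_closure_def
proof (rule normal_generateI)
  show "{x \<otimes> r \<otimes> inv x | x r. x \<in> carrier G \<and> r \<in> R} \<subseteq> carrier G"
    using assms by auto
next
  fix h y assume "h \<in> {x \<otimes> r \<otimes> inv x | x r. x \<in> carrier G \<and> r \<in> R}" and y: "y \<in> carrier G"
  then obtain x r where h: "h = x \<otimes> r \<otimes> inv x" "x \<in> carrier G" "r \<in> R" by blast
  have "y \<otimes> h \<otimes> inv y = (y \<otimes> x) \<otimes> r \<otimes> inv (y \<otimes> x)"
    using h y assms by (auto simp: inv_mult_group m_assoc)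
  then show "y \<otimes> h \<otimes> inv y \<in> {x \<otimes> r \<otimes> inv x | x r. x \<in> carrier G \<and> r \<in> R}"
    using h y by blast
qed

lemma group_presented_group:
  assumes "R \<subseteq> carrier (free_group S) \<times> carrier (free_group S)"
  shows "group (presented_group S R)"
proof -
  interpret F: group "free_group S" by (rule group_free_group)
  have "relators S R \<subseteq> carrier (free_group S)"
    using assms by (auto simp: relators_def)
  then show ?thesis
    unfolding presented_group_def
    by (intro normal.factorgroup_is_group F.normal_closure_normal)
qed


section \<open>Braid groups\<close>

text \<open>The braid group on \<open>n\<close> strands; the generators are indexed by \<open>1, \<dots>, n - 1\<close>.\<close>

definition braid_relations :: "nat \<Rightarrow> (nat word \<times> nat word) set" where
  "braid_relations n =
    (let F = free_group {1..<n}; s = free_gen in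
      {(s i \<otimes>\<^bsub>F\<^esub> s j, s j \<otimes>\<^bsub>F\<^esub> s i) | i j.
         i \<in> {1..<n} \<and> j \<in> {1..<n} \<and> \<bar>int i - int j\<bar> > 1} \<union>
      {(s i \<otimes>\<^bsub>F\<^esub> s j \<otimes>\<^bsub>F\<^esub> s i, s j \<otimes>\<^bsub>F\<^esub> s i \<otimes>\<^bsub>F\<^esub> s j) | i j.
         i \<in> {1..<n} \<and> j \<in> {1..<n} \<and> \<bar>int i - int j\<bar> = 1})"

definition braid_group :: "nat \<Rightarrow> nat word set monoid" where
  "braid_group n = presented_group {1..<n} (braid_relations n)"

definition braid_gen :: "nat \<Rightarrow> nat \<Rightarrow> nat word set" where
  "braid_gen n i = presented_gen {1..<n} (braid_relations n) i"

lemma group_braid_group: "group (braid_group n)"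
proof -
  interpret F: group "free_group {1..<n}" by (rule group_free_group)
  have "braid_relations n \<subseteq> carrier (free_group {1..<n}) \<times> carrier (free_group {1..<n})"
    unfolding braid_relations_def Let_def
    by (auto intro!: F.m_closed free_gen_closed simp del: One_nat_def)
  then show ?thesis
    unfolding braid_group_def by (rule group_presented_group)
qed


section \<open>The free group of rank \<open>2 g\<close> and the automorphisms \<open>u\<^sub>i\<close>\<close>

datatype gen = A nat | B nat

definition gens :: "nat \<Rightarrow> gen set" where
  "gens g = A ` {1..g} \<union> B ` {1..g}"

definition F2 :: "nat \<Rightarrow> gen word monoid" where
  "F2 g = free_group (gens g)"

definition u_on_gens :: "nat \<Rightarrow> nat \<Rightarrow> gen \<Rightarrow> gen word" where
  "u_on_gens g i =
    (let a = (\<lambda>k. free_gen (A k)); b = (\<lambda>k. free_gen (B k)) in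
     if i = 1 then
       free_gen(B 1 := a 1 \<otimes>\<^bsub>F2 g\<^esub> b 1)
     else if i = 2 * g + 1 then
       free_gen(B g := b g \<otimes>\<^bsub>F2 g\<^esub> a g)
     else if even i then
       (let k = i div 2 in
         free_gen(A k := inv\<^bsub>F2 g\<^esub> b k \<otimes>\<^bsub>F2 g\<^esub> a k))
     else
       (let k = i div 2 in
         free_gen(B k := b k \<otimes>\<^bsub>F2 g\<^esub> a k \<otimes>\<^bsub>F2 g\<^esub> inv\<^bsub>F2 g\<^esub> a (k + 1),
                  B (k + 1) := a (k + 1) \<otimes>\<^bsub>F2 g\<^esub> inv\<^bsub>F2 g\<^esub> a k \<otimes>\<^bsub>F2 g\<^esub> b (k + 1))))"

definition u :: "nat \<Rightarrow> nat \<Rightarrow> gen word \<Rightarrow> gen word" where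
  "u g i = free_lift (gens g) (F2 g) (u_on_gens g i)"

lemma u_on_gens_closed:
  assumes "i \<in> {1..2 * g + 1}" "g \<ge> 1"
  shows "u_on_gens g i \<in> gens g \<rightarrow> carrier (F2 g)"
proof -
  interpret F: group "F2 g" unfolding F2_def by (rule group_free_group)
  have a: "free_gen (A k) \<in> carrier (F2 g)" and b: "free_gen (B k) \<in> carrier (F2 g)"
    if "1 \<le> k" "k \<le> g" for k
    using that by (auto simp: F2_def gens_def intro!: free_gen_closed)
  have id: "free_gen \<in> gens g \<rightarrow> carrier (F2 g)"
    by (auto simp: F2_def intro: free_gen_closed)
  have upd: "h(x := w) \<in> gens g \<rightarrow> carrier (F2 g)"
    if "h \<in> gens g \<rightarrow> carrier (F2 g)" "w \<in> carrier (F2 g)" for h x w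
    using that by auto
  have "1 \<le> i div 2 \<and> i div 2 \<le> g" if "i \<noteq> 1"
    using that assms by auto
  moreover have "i div 2 + 1 \<le> g" if "odd i" "i \<noteq> 2 * g + 1"
    using that assms by (auto elim!: oddE)
  ultimately show ?thesis
    using assms unfolding u_on_gens_def Let_def
    by (simp del: One_nat_def split: if_split) (intro conjI impI upd id F.m_closed F.inv_closed a b; simp)
qed

lemma u_hom:
  assumes "i \<in> {1..2 * g + 1}" "g \<ge> 1"
  shows "u g i \<in> hom (F2 g) (F2 g)"
  using free_lift_hom[OF group_free_group u_on_gens_closed[OF assms, unfolded F2_def]]
  by (simp add: u_def F2_def)

lemma u_gen:
  assumes "i \<in> {1..2 * g + 1}" "g \<ge> 1" "s \<in> gens g"
  shows "u g i (free_gen s) = u_on_gens g i s"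
  using free_lift_gen[OF group_free_group u_on_gens_closed[OF assms(1,2), unfolded F2_def] assms(3)]
  by (simp add: u_def F2_def)

end

theory Submission
  imports Defs
begin

text \<open>
  Each \<open>u\<^sub>i\<close> sends a generator \<open>s\<close> to \<open>l\<^sub>i(s) s r\<^sub>i(s)\<close>, where the factors \<open>l\<^sub>i(s)\<close> and \<open>r\<^sub>i(s)\<close>
  are fixed by \<open>u\<^sub>j\<close> unless \<open>|i - j| = 1\<close>. Hence \<open>s \<mapsto> l\<^sub>i(s)\<^sup>-\<^sup>1 s r\<^sub>i(s)\<^sup>-\<^sup>1\<close> is inverse to \<open>u\<^sub>i\<close>, and for
  \<open>|i - j| > 1\<close> both products \<open>u\<^sub>i u\<^sub>j\<close> and \<open>u\<^sub>j u\<^sub>i\<close> multiply \<open>s\<close> by the factors of \<open>u\<^sub>i\<close> and \<open>u\<^sub>j\<close>,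
  at most one of which is nontrivial on each side. The braid relation is a calculation on generators.
\<close>

section \<open>Homomorphisms out of free and presented groups\<close>

text \<open>Together with \<open>m_assoc\<close>, which nests products to the right, these rules
  cancel adjacent inverse factors in the word calculations below.\<close>

lemma (in group) inv_cancel_left [simp]:
  assumes "x \<in> carrier G" "y \<in> carrier G"
  shows "inv x \<otimes> (x \<otimes> y) = y" "x \<otimes> (inv x \<otimes> y) = y"
  using assms by (simp_all flip: m_assoc)

text \<open>The generators generate the free group, and agreement passes to products and inverses.
  Identities between composites of the \<open>u g i\<close> thereby reduce to generators.\<close>

lemma free_hom_eqI:
  assumes "group H" "h \<in> hom (free_group S) H" "k \<in> hom (free_group S) H"
    and eq: "\<And>s. s \<in> S \<Longrightarrow> h (free_gen s) = k (free_gen s)"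
    and "w \<in> carrier (free_group S)"
  shows "h w = k w"
proof -
  interpret h: group_hom "free_group S" H h
    by (intro group_hom.intro group_hom_axioms.intro group_free_group assms)
  interpret k: group_hom "free_group S" H k
    by (intro group_hom.intro group_hom_axioms.intro group_free_group assms)
  have "w \<in> generate (free_group S) (free_gen ` S)"
    using assms by (simp add: free_group_generated)
  then show ?thesis
  proof induction
    case (eng x y)
    then have "x \<in> carrier (free_group S)" "y \<in> carrier (free_group S)"
      by (simp_all add: free_group_generated)
    with eng show ?case by simp
  qed (auto simp: eq free_gen_closed)
qed

text \<open>Universal property of a presentation: \<open>rel\<close> puts every relator in the
  kernel of \<open>free_lift S H \<phi>\<close>. The kernel is a normal subgroup, so it contains
  their normal closure, and the lift factors through the quotient.\<close>

lemma presented_group_hom: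
  assumes "group H" and R: "R \<subseteq> carrier (free_group S) \<times> carrier (free_group S)"
    and \<phi>: "\<phi> \<in> S \<rightarrow> carrier H"
    and rel: "\<And>v w. (v, w) \<in> R \<Longrightarrow> free_lift S H \<phi> v = free_lift S H \<phi> w"
  obtains f where "group_hom (presented_group S R) H f"
    "\<And>s. s \<in> S \<Longrightarrow> f (presented_gen S R s) = \<phi> s"
proof -
  interpret h: group_hom "free_group S" H "free_lift S H \<phi>"
    by (intro group_hom.intro group_hom_axioms.intro group_free_group free_lift_hom assms)
  let ?K = "kernel (free_group S) H (free_lift S H \<phi>)"
  let ?N = "normal_closure (free_group S) (relators S R)"
  have relators: "relators S R \<subseteq> ?K"
  proof
    fix x assume "x \<in> relators S R"
    then obtain v w where vw: "(v, w) \<in> R" "x = v \<otimes>\<^bsub>free_group S\<^esub> inv\<^bsub>free_group S\<^esub> w"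
      by (auto simp: relators_def)
    then have "v \<in> carrier (free_group S)" "w \<in> carrier (free_group S)"
      using R by auto
    with vw rel[of v w] show "x \<in> ?K"
      by (simp add: kernel_def)
  qed
  then have N: "?N \<lhd> free_group S"
    by (intro h.G.normal_closure_normal) (auto simp: kernel_def)
  have "?N \<subseteq> ?K"
    unfolding normal_closure_def using relators
    by (intro h.G.generate_subgroup_incl h.subgroup_kernel)
      (auto intro!: normal.inv_op_closed2[OF h.normal_kernel])
  then obtain f where f: "f \<in> hom (presented_group S R) H"
    "\<And>x. x \<in> carrier (free_group S) \<Longrightarrow> f (?N #>\<^bsub>free_group S\<^esub> x) = free_lift S H \<phi> x"
    unfolding presented_group_def using h.FactGroup_universal_kernel[OF N] by blast
  show thesis
  proof
    show "group_hom (presented_group S R) H f"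
      by (intro group_hom.intro group_hom_axioms.intro group_presented_group assms f)
    show "f (presented_gen S R s) = \<phi> s" if "s \<in> S" for s
      using that assms by (simp add: presented_gen_def f free_gen_closed free_lift_gen)
  qed
qed

lemma braid_relations_closed:
  "braid_relations n \<subseteq> carrier (free_group {1..<n}) \<times> carrier (free_group {1..<n})"
proof -
  interpret F: group "free_group {1..<n}" by (rule group_free_group)
  show ?thesis
    unfolding braid_relations_def Let_def
    by (auto intro!: F.m_closed free_gen_closed simp del: One_nat_def)
qed

section \<open>Automorphism groups\<close>

text \<open>The two-sided inverse \<open>k\<close> gives bijectivity on the carrier;
  \<open>extensional\<close> is demanded by \<open>Bij\<close>, so that automorphisms agreeing on
  the carrier are equal.\<close>

lemma autoI:
  assumes "f \<in> hom G G" "f \<in> extensional (carrier G)" "k \<in> hom G G"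
    and "\<And>x. x \<in> carrier G \<Longrightarrow> k (f x) = x" "\<And>x. x \<in> carrier G \<Longrightarrow> f (k x) = x"
  shows "f \<in> auto G"
proof -
  have "bij_betw f (carrier G) (carrier G)"
    using assms by (intro bij_betw_byWitness[where f' = k]) (auto dest: hom_in_carrier)
  then show ?thesis
    using assms by (simp add: auto_def Bij_def)
qed

lemma AutoGroup_carrier [simp]: "carrier (AutoGroup G) = auto G"
  by (simp add: AutoGroup_def)

lemma AutoGroup_mult [simp]:
  assumes "f \<in> auto G" "k \<in> auto G"
  shows "f \<otimes>\<^bsub>AutoGroup G\<^esub> k = compose (carrier G) f k"
  using assms by (simp add: AutoGroup_def BijGroup_def auto_def)

section \<open>The factors by which \<open>u g i\<close> multiplies a generator\<close>

interpretation F2: group "F2 g" for g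
  unfolding F2_def by (rule group_free_group)

lemma gens_iff [simp]: "A k \<in> gens g \<longleftrightarrow> k \<in> {1..g}" "B k \<in> gens g \<longleftrightarrow> k \<in> {1..g}"
  by (auto simp: gens_def)

lemma F2_gen_closed [simp]: "s \<in> gens g \<Longrightarrow> free_gen s \<in> carrier (F2 g)"
  by (simp add: F2_def free_gen_closed)

text \<open>With the convention \<open>a\<^sub>0 = a\<^bsub>g+1\<^esub> = 1\<close> the formula for \<open>u\<^bsub>2k+1\<^esub>\<close> with \<open>1 \<le> k < g\<close> also
  gives \<open>u\<^sub>1\<close> and \<open>u\<^bsub>2g+1\<^esub>\<close>.\<close>

definition ext_a :: "nat \<Rightarrow> nat \<Rightarrow> gen word" where
  "ext_a g k = (if k \<in> {1..g} then free_gen (A k) else \<one>\<^bsub>F2 g\<^esub>)"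

text \<open>The factor that u_(2k+1) puts to the right of b_k; its inverse goes to the left of
  b_(k+1). For \<open>g \<ge> 1\<close>, \<open>link g 0\<close> is the inverse of a_1 and
  \<open>link g g\<close> is a_g.\<close>

definition link :: "nat \<Rightarrow> nat \<Rightarrow> gen word" where
  "link g k = ext_a g k \<otimes>\<^bsub>F2 g\<^esub> inv\<^bsub>F2 g\<^esub> ext_a g (k + 1)"

text \<open>\<open>i + 1 = 2 * k\<close> expresses i = 2(k - 1) + 1 without truncated subtraction;
  in that case \<open>i div 2\<close> is k - 1.\<close>

fun u_left :: "nat \<Rightarrow> nat \<Rightarrow> gen \<Rightarrow> gen word" where
  "u_left g i (A k) = (if i = 2 * k then inv\<^bsub>F2 g\<^esub> free_gen (B k) else \<one>\<^bsub>F2 g\<^esub>)"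
| "u_left g i (B k) = (if i + 1 = 2 * k then inv\<^bsub>F2 g\<^esub> link g (i div 2) else \<one>\<^bsub>F2 g\<^esub>)"

fun u_right :: "nat \<Rightarrow> nat \<Rightarrow> gen \<Rightarrow> gen word" where
  "u_right g i (A k) = \<one>\<^bsub>F2 g\<^esub>"
| "u_right g i (B k) = (if i = 2 * k + 1 then link g k else \<one>\<^bsub>F2 g\<^esub>)"

lemma ext_a_closed [simp]: "ext_a g k \<in> carrier (F2 g)"
  by (simp add: ext_a_def)

lemma link_closed [simp]: "link g k \<in> carrier (F2 g)"
  by (simp add: link_def)

lemma u_left_closed [simp]: "s \<in> gens g \<Longrightarrow> u_left g i s \<in> carrier (F2 g)"
  by (cases s) auto

lemma u_right_closed [simp]: "s \<in> gens g \<Longrightarrow> u_right g i s \<in> carrier (F2 g)"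
  by (cases s) auto

lemma u_on_gens_eq:
  assumes "i \<in> {1..2 * g + 1}" "s \<in> gens g"
  shows "u_on_gens g i s = u_left g i s \<otimes>\<^bsub>F2 g\<^esub> free_gen s \<otimes>\<^bsub>F2 g\<^esub> u_right g i s"
proof (cases "even i")
  case True
  then have "Suc i \<noteq> 2 * m" "i \<noteq> Suc (2 * m)" for m by presburger+
  then show ?thesis
    using assms True by (cases s) (auto simp: u_on_gens_def)
next
  case False
  then obtain m where m: "i = Suc (2 * m)" by (auto elim: oddE)
  have "Suc (2 * m) \<noteq> 2 * n" for n by presburger
  then show ?thesis
    using assms unfolding m
    by (cases s) (auto simp: u_on_gens_def Let_def link_def ext_a_def F2.inv_mult_group F2.m_assoc)
qed

lemma u_free_gen:
  assumes "i \<in> {1..2 * g + 1}" "s \<in> gens g"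
  shows "u g i (free_gen s) = u_left g i s \<otimes>\<^bsub>F2 g\<^esub> free_gen s \<otimes>\<^bsub>F2 g\<^esub> u_right g i s"
proof -
  have "g \<ge> 1" using assms(2) by (cases s) auto
  then show ?thesis using assms by (simp add: u_gen u_on_gens_eq)
qed

text \<open>The factors of u_j involve only b_k if j = 2k, and only a_k and a_(k+1) if j = 2k + 1;
  u_i moves one of these letters only if i is j - 1 or j + 1. The case i = j is included, and
  \<open>h\<close> is left general so that the inverse of u_i is covered as well as u_i.\<close>

lemma fixes_u_factors:
  assumes "group_hom (F2 g) (F2 g) h"
    and fixed: "\<And>s. \<lbrakk>s \<in> gens g; u_left g i s = \<one>\<^bsub>F2 g\<^esub>; u_right g i s = \<one>\<^bsub>F2 g\<^esub>\<rbrakk>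
      \<Longrightarrow> h (free_gen s) = free_gen s"
    and far: "\<bar>int i - int j\<bar> \<noteq> 1" and s: "s \<in> gens g"
  shows "h (u_left g j s) = u_left g j s" "h (u_right g j s) = u_right g j s"
proof -
  interpret h: group_hom "F2 g" "F2 g" h by fact
  have a: "h (ext_a g k) = ext_a g k" if "i \<noteq> 2 * k" for k
    using that fixed[of "A k"] by (simp add: ext_a_def)
  have b: "h (free_gen (B k)) = free_gen (B k)" if "j = 2 * k" "k \<in> {1..g}" for k
    using that far by (intro fixed) auto
  have link: "h (link g k) = link g k" if "j = 2 * k + 1" for k
    using that far by (simp add: link_def a)
  show "h (u_left g j s) = u_left g j s"
  proof (cases s)
    case (A k)
    then show ?thesis using s b[of k] by simp
  next
    case (B k)
    moreover have "j = 2 * (j div 2) + 1" if "j + 1 = 2 * k" using that by presburger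
    ultimately show ?thesis using s link[of "j div 2"] by auto
  qed
  show "h (u_right g j s) = u_right g j s"
    using s link by (cases s) auto
qed

section \<open>Invertibility of the \<open>u g i\<close> and the relations between them\<close>

context
  fixes g :: nat
  assumes g: "g \<ge> 1"
begin

lemma u_group_hom:
  assumes "i \<in> {1..2 * g + 1}"
  shows "group_hom (F2 g) (F2 g) (u g i)"
  using u_hom[OF assms g] by (intro group_hom.intro group_hom_axioms.intro F2.is_group)

lemma u_auto:
  assumes i: "i \<in> {1..2 * g + 1}"
  shows "u g i \<in> auto (F2 g)"
proof -
  interpret u: group_hom "F2 g" "F2 g" "u g i" using i by (rule u_group_hom)
  define \<psi> where
    "\<psi> s = inv\<^bsub>F2 g\<^esub> u_left g i s \<otimes>\<^bsub>F2 g\<^esub> free_gen s \<otimes>\<^bsub>F2 g\<^esub> inv\<^bsub>F2 g\<^esub> u_right g i s" for s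
  define k where "k = free_lift (gens g) (F2 g) \<psi>"
  have \<psi>: "\<psi> \<in> gens g \<rightarrow> carrier (F2 g)" by (auto simp: \<psi>_def)
  interpret k: group_hom "F2 g" "F2 g" k
    using free_lift_hom[OF F2.is_group \<psi>]
    by (intro group_hom.intro group_hom_axioms.intro F2.is_group) (simp_all add: k_def F2_def)
  have k_gen: "k (free_gen s) = \<psi> s" if "s \<in> gens g" for s
    using free_lift_gen[OF F2.is_group \<psi> that] by (simp add: k_def)
  \<comment> \<open>The case i = j of \<open>fixes_u_factors\<close>: both \<open>k\<close> and
    \<open>u g i\<close> fix the factors, which then cancel in the composites.\<close>
  have k_fix: "k (u_left g i s) = u_left g i s" "k (u_right g i s) = u_right g i s"
    if "s \<in> gens g" for s
    using fixes_u_factors[OF k.group_hom_axioms, of i i s] that by (auto simp: k_gen \<psi>_def)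
  have u_fix: "u g i (u_left g i s) = u_left g i s" "u g i (u_right g i s) = u_right g i s"
    if "s \<in> gens g" for s
    using fixes_u_factors[OF u.group_hom_axioms, of i i s] that by (auto simp: u_free_gen[OF i])
  show ?thesis
  proof (rule autoI)
    show "u g i \<in> extensional (carrier (F2 g))"
      by (simp add: u_def free_lift_def F2_def)
    have "(k \<circ> u g i) x = id x" if "x \<in> carrier (F2 g)" for x
      using that unfolding F2_def
    proof (rule free_hom_eqI[OF group_free_group, rotated -1])
      show "k \<circ> u g i \<in> hom (free_group (gens g)) (free_group (gens g))"
        using hom_compose[OF u.homh k.homh] by (simp add: F2_def)
      show "(k \<circ> u g i) (free_gen s) = id (free_gen s)" if "s \<in> gens g" for s
        using that by (simp add: u_free_gen[OF i] k_fix k_gen \<psi>_def F2.m_assoc)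
    qed (auto simp: hom_def)
    then show "k (u g i x) = x" if "x \<in> carrier (F2 g)" for x
      using that by simp
    have "(u g i \<circ> k) x = id x" if "x \<in> carrier (F2 g)" for x
      using that unfolding F2_def
    proof (rule free_hom_eqI[OF group_free_group, rotated -1])
      show "u g i \<circ> k \<in> hom (free_group (gens g)) (free_group (gens g))"
        using hom_compose[OF k.homh u.homh] by (simp add: F2_def)
      show "(u g i \<circ> k) (free_gen s) = id (free_gen s)" if "s \<in> gens g" for s
        using that by (simp add: u_free_gen[OF i] u_fix k_gen \<psi>_def F2.m_assoc)
    qed (auto simp: hom_def)
    then show "u g i (k x) = x" if "x \<in> carrier (F2 g)" for x
      using that by simp
  qed (use u.homh k.homh in auto)
qed

lemma u_far_commute:
  assumes i: "i \<in> {1..2 * g + 1}" and j: "j \<in> {1..2 * g + 1}" and far: "\<bar>int i - int j\<bar> > 1"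
  shows "u g i \<otimes>\<^bsub>AutoGroup (F2 g)\<^esub> u g j = u g j \<otimes>\<^bsub>AutoGroup (F2 g)\<^esub> u g i"
proof -
  interpret ui: group_hom "F2 g" "F2 g" "u g i" using i by (rule u_group_hom)
  interpret uj: group_hom "F2 g" "F2 g" "u g j" using j by (rule u_group_hom)
  have "(u g i \<circ> u g j) x = (u g j \<circ> u g i) x" if "x \<in> carrier (F2 g)" for x
    using that unfolding F2_def
  proof (rule free_hom_eqI[OF group_free_group, rotated -1])
    show "u g i \<circ> u g j \<in> hom (free_group (gens g)) (free_group (gens g))"
      using hom_compose[OF uj.homh ui.homh] by (simp add: F2_def)
    show "u g j \<circ> u g i \<in> hom (free_group (gens g)) (free_group (gens g))"
      using hom_compose[OF ui.homh uj.homh] by (simp add: F2_def)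
    fix s assume s: "s \<in> gens g"
    have ui_fix: "u g i (u_left g j s) = u_left g j s" "u g i (u_right g j s) = u_right g j s"
      using fixes_u_factors[OF ui.group_hom_axioms, of i j s] s far
      by (auto simp: u_free_gen[OF i])
    have uj_fix: "u g j (u_left g i s) = u_left g i s" "u g j (u_right g i s) = u_right g i s"
      using fixes_u_factors[OF uj.group_hom_axioms, of j i s] s far
      by (auto simp: u_free_gen[OF j])
    \<comment> \<open>A left factor is nontrivial only for index 2k on a_k and 2k - 1 on b_k, a
      right factor only for index 2k + 1 on b_k. So each side of a generator admits a single index,
      whereas i and j differ.\<close>
    have "u_left g i s = \<one>\<^bsub>F2 g\<^esub> \<or> u_left g j s = \<one>\<^bsub>F2 g\<^esub>"
      using far by (cases s) auto
    moreover have "u_right g i s = \<one>\<^bsub>F2 g\<^esub> \<or> u_right g j s = \<one>\<^bsub>F2 g\<^esub>"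
      using far by (cases s) auto
    ultimately show "(u g i \<circ> u g j) (free_gen s) = (u g j \<circ> u g i) (free_gen s)"
      using s by (auto simp: u_free_gen[OF i] u_free_gen[OF j] ui_fix uj_fix F2.m_assoc)
  qed
  then show ?thesis
    using u_auto[OF i] u_auto[OF j] by (auto simp: compose_def)
qed

text \<open>Write \<open>E\<close> for u_(2k), \<open>D\<close> for u_(2l+1) and c for
  \<open>link g l\<close>. \<open>D\<close> fixes c, while \<open>E\<close> multiplies c by b_k or
  its inverse, and both sides reduce to the same word: for l = k, both send b_k to c and a_k to c^-1
  b_k^-1 a_k. Keeping c unexpanded treats the ends l = 0 and l = g like the rest.\<close>

lemma u_braid_on_gens:
  assumes k: "k \<in> {1..g}" and l: "l = k \<or> Suc l = k" and s: "s \<in> gens g"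
  shows "u g (2 * k) (u g (2 * l + 1) (u g (2 * k) (free_gen s))) =
    u g (2 * l + 1) (u g (2 * k) (u g (2 * l + 1) (free_gen s)))"
proof -
  define E D where "E = u g (2 * k)" and "D = u g (2 * l + 1)"
  define c where "c = link g l"
  have E: "2 * k \<in> {1..2 * g + 1}" and D: "2 * l + 1 \<in> {1..2 * g + 1}"
    using k l by auto
  interpret E: group_hom "F2 g" "F2 g" E unfolding E_def using E by (rule u_group_hom)
  interpret D: group_hom "F2 g" "F2 g" D unfolding D_def using D by (rule u_group_hom)
  have parity: "Suc (2 * m) \<noteq> 2 * n" "2 * n \<noteq> Suc (2 * m)" for m n :: nat
    by presburger+
  have c [simp]: "c \<in> carrier (F2 g)" by (simp add: c_def)
  have E_A: "E (free_gen (A m)) =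
      (if m = k then inv\<^bsub>F2 g\<^esub> free_gen (B k) \<otimes>\<^bsub>F2 g\<^esub> free_gen (A k) else free_gen (A m))"
    and E_B: "E (free_gen (B m)) = free_gen (B m)"
    and D_A: "D (free_gen (A m)) = free_gen (A m)"
    and D_B: "D (free_gen (B m)) = (if m = Suc l then inv\<^bsub>F2 g\<^esub> c else \<one>\<^bsub>F2 g\<^esub>) \<otimes>\<^bsub>F2 g\<^esub>
      free_gen (B m) \<otimes>\<^bsub>F2 g\<^esub> (if m = l then c else \<one>\<^bsub>F2 g\<^esub>)"
    if "m \<in> {1..g}" for m
    using that k u_free_gen[OF E, of "A m"] u_free_gen[OF E, of "B m"]
      u_free_gen[OF D, of "A m"] u_free_gen[OF D, of "B m"]
    by (auto simp: E_def D_def c_def parity)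
  have D_c: "D c = c"
    by (simp add: c_def link_def ext_a_def D_A)
  have E_ext: "E (ext_a g m) =
      (if m = k then inv\<^bsub>F2 g\<^esub> free_gen (B k) \<otimes>\<^bsub>F2 g\<^esub> ext_a g k else ext_a g m)" for m
    using k by (simp add: ext_a_def E_A)
  \<comment> \<open>If l = k, then a_k is the first letter of c; if l + 1 = k, its inverse is the
    last. Hence b_k^-1 appears on the left or b_k on the right.\<close>
  have "E c = (if l = k then inv\<^bsub>F2 g\<^esub> free_gen (B k) \<otimes>\<^bsub>F2 g\<^esub> c else c \<otimes>\<^bsub>F2 g\<^esub> free_gen (B k))"
    using k l by (auto simp: c_def link_def E_ext F2.m_assoc F2.inv_mult_group)
  then have "E (D (E (free_gen s))) = D (E (D (free_gen s)))"
    using s k l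
    by (cases s) (auto simp: E_A E_B D_A D_B D_c F2.m_assoc F2.inv_mult_group)
  then show ?thesis by (simp add: E_def D_def)
qed

lemma u_braid_even_odd:
  assumes k: "k \<in> {1..g}" and l: "l = k \<or> Suc l = k"
  defines "E \<equiv> u g (2 * k)" and "D \<equiv> u g (2 * l + 1)"
  shows "E \<otimes>\<^bsub>AutoGroup (F2 g)\<^esub> D \<otimes>\<^bsub>AutoGroup (F2 g)\<^esub> E =
    D \<otimes>\<^bsub>AutoGroup (F2 g)\<^esub> E \<otimes>\<^bsub>AutoGroup (F2 g)\<^esub> D"
proof -
  have range: "2 * k \<in> {1..2 * g + 1}" "2 * l + 1 \<in> {1..2 * g + 1}"
    using k l by auto
  interpret Aut: group "AutoGroup (F2 g)" by (rule F2.AutoGroup)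
  interpret E: group_hom "F2 g" "F2 g" E unfolding E_def using range(1) by (rule u_group_hom)
  interpret D: group_hom "F2 g" "F2 g" D unfolding D_def using range(2) by (rule u_group_hom)
  have ED: "E \<in> auto (F2 g)" "D \<in> auto (F2 g)"
    unfolding E_def D_def using range by (intro u_auto; simp)+
  have eq: "(E \<circ> D \<circ> E) x = (D \<circ> E \<circ> D) x" if "x \<in> carrier (F2 g)" for x
    using that unfolding F2_def
  proof (rule free_hom_eqI[OF group_free_group, rotated -1])
    show "E \<circ> D \<circ> E \<in> hom (free_group (gens g)) (free_group (gens g))"
      using hom_compose[OF E.homh hom_compose[OF D.homh E.homh]] by (simp add: F2_def)
    show "D \<circ> E \<circ> D \<in> hom (free_group (gens g)) (free_group (gens g))"
      using hom_compose[OF D.homh hom_compose[OF E.homh D.homh]] by (simp add: F2_def)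
    show "(E \<circ> D \<circ> E) (free_gen s) = (D \<circ> E \<circ> D) (free_gen s)" if "s \<in> gens g" for s
      using u_braid_on_gens[OF k l that] by (simp add: E_def D_def)
  qed
  \<comment> \<open>A triple product has a composite as a factor, and \<open>AutoGroup_mult\<close>
    asks for that factor to be an automorphism.\<close>
  have mult_auto: "compose (carrier (F2 g)) p q \<in> auto (F2 g)"
    if "p \<in> auto (F2 g)" "q \<in> auto (F2 g)" for p q
    using Aut.m_closed[of p q] that by simp
  show ?thesis
    using ED by (simp add: mult_auto) (use eq in \<open>auto simp: compose_def\<close>)
qed

lemma u_braid:
  assumes i: "i \<in> {1..2 * g + 1}" and j: "j \<in> {1..2 * g + 1}" and ij: "\<bar>int i - int j\<bar> = 1"
  shows "u g i \<otimes>\<^bsub>AutoGroup (F2 g)\<^esub> u g j \<otimes>\<^bsub>AutoGroup (F2 g)\<^esub> u g i =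
    u g j \<otimes>\<^bsub>AutoGroup (F2 g)\<^esub> u g i \<otimes>\<^bsub>AutoGroup (F2 g)\<^esub> u g j"
\<comment> \<open>Adjacent indices have opposite parity and the relation is symmetric in i and j, so
  the even index always plays the role of 2k.\<close>
proof (cases "even i")
  case True
  define k l where "k = i div 2" and "l = j div 2"
  have eqs: "i = 2 * k" "j = 2 * l + 1"
    using True ij unfolding k_def l_def by presburger+
  then have "k \<in> {1..g}" "l = k \<or> Suc l = k"
    using i j ij by auto
  from u_braid_even_odd[OF this] show ?thesis by (simp only: eqs)
next
  case False
  define k l where "k = j div 2" and "l = i div 2"
  have eqs: "j = 2 * k" "i = 2 * l + 1"
    using False ij unfolding k_def l_def by presburger+
  then have "k \<in> {1..g}" "l = k \<or> Suc l = k"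
    using i j ij by auto
  from u_braid_even_odd[OF this] show ?thesis by (simp only: eqs)
qed

end

section \<open>The homomorphism on the braid group\<close>

theorem theorem2p1:
  fixes g :: nat
  assumes "g \<ge> 1"
  shows "\<exists>f. group_hom (braid_group (2 * g + 2)) (AutoGroup (F2 g)) f \<and>
             (\<forall>i \<in> {1..2 * g + 1}. f (braid_gen (2 * g + 2) i) = u g i)"
proof -
  let ?Aut = "AutoGroup (F2 g)"
  define S where "S = {1..<2 * g + 2}"
  have S: "S = {1..2 * g + 1}" by (auto simp: S_def)
  interpret F: group "free_group S" by (rule group_free_group)
  interpret Aut: group ?Aut by (rule F2.AutoGroup)
  have u: "u g \<in> S \<rightarrow> carrier ?Aut"
    unfolding S AutoGroup_carrier by (intro Pi_I u_auto assms)
  interpret h: group_hom "free_group S" ?Aut "free_lift S ?Aut (u g)"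
    by (intro group_hom.intro group_hom_axioms.intro free_lift_hom u F.is_group Aut.is_group)
  have gen: "free_gen i \<in> carrier (free_group S)"
    "free_lift S ?Aut (u g) (free_gen i) = u g i" if "i \<in> S" for i
    using that by (simp_all only: free_gen_closed free_lift_gen[OF Aut.is_group u])
  \<comment> \<open>The lift is a homomorphism, so each braid relation turns into the corresponding
    relation between the \<open>u g i\<close>.\<close>
  have rel: "free_lift S ?Aut (u g) v = free_lift S ?Aut (u g) w"
    if "(v, w) \<in> braid_relations (2 * g + 2)" for v w
    using that unfolding braid_relations_def Let_def S_def[symmetric]
  proof (elim UnE CollectE exE conjE)
    fix i j
    assume "(v, w) = (free_gen i \<otimes>\<^bsub>free_group S\<^esub> free_gen j,
        free_gen j \<otimes>\<^bsub>free_group S\<^esub> free_gen i)"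
      "i \<in> S" "j \<in> S" "\<bar>int i - int j\<bar> > 1"
    then show ?thesis
      using u_far_commute[OF assms, of i j, folded S] gen[of i] gen[of j]
      by (simp del: AutoGroup_mult)
  next
    fix i j
    assume "(v, w) = (free_gen i \<otimes>\<^bsub>free_group S\<^esub> free_gen j \<otimes>\<^bsub>free_group S\<^esub> free_gen i,
        free_gen j \<otimes>\<^bsub>free_group S\<^esub> free_gen i \<otimes>\<^bsub>free_group S\<^esub> free_gen j)"
      "i \<in> S" "j \<in> S" "\<bar>int i - int j\<bar> = 1"
    then show ?thesis
      using u_braid[OF assms, of i j, folded S] gen[of i] gen[of j]
      by (simp del: AutoGroup_mult)
  qed
  obtain f where "group_hom (braid_group (2 * g + 2)) ?Aut f"
    "\<And>i. i \<in> S \<Longrightarrow> f (braid_gen (2 * g + 2) i) = u g i"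
    unfolding braid_group_def braid_gen_def S_def[symmetric]
    using presented_group_hom[OF Aut.is_group _ u rel] braid_relations_closed[of "2 * g + 2", folded S_def] by blast
  then show ?thesis by (auto simp: S)
qed

end
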